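(* Let $\mathcal{C}_{con}(G)$ denote the class of connected sets of a finite simple undirected graph $G$. Then: (1) for every finite tree $T$: $\mathrm{RTD}(\mathcal{C}_{con}(T))=\ell(T)$; (2) for every connected finite graph $G$: $\mathrm{RTD}(\mathcal{C}_{con}(G))\ge \ell(G)$; (3) for every finite graph $G$: $\ell(G)\le \mathrm{RTD}(\mathcal{C}_{con}(G))\le \ell(G)+1$.
   Context: For a graph $G=(V,E)$, $\mathcal{C}_{con}(G)$ is the concept class over domain $V$ consisting of the empty set together with all nonempty $X\subseteq V$ such that the subgraph of $G$ induced by $X$ is connected. For a connected graph $G$, $\ell(G)$ is the number of leaves (degree-1 vertices) of a spanning tree of $G$ with the maximum possible number of leaves; for a tree $T$, $\ell(T)$ is its number of leaves. For a graph with connected components $G_1,\dots,G_r$, $\ell(G)=\max_i \ell(G_i)$. For a finite concept class $\mathcal{C}$ over a finite domain $\mathcal{X}$, a teaching set for $C\in\mathcal{C}$ is $D\subseteq\mathcal{X}$ such that for every $C'\in\mathcal{C}\setminus\{C\}$ there is $x\in D$ with ($x\in C\iff x\notin C'$); $\mathrm{TD}(C,\mathcal{C})$ is the minimum size of such a set, $\mathrm{TD}_{min}(\mathcal{C})=\min_C\mathrm{TD}(C,\mathcal{C})$, $\mathcal{C}_{min}=\{C:\mathrm{TD}(C,\mathcal{C})=\mathrm{TD}_{min}(\mathcal{C})\}$, and $\mathrm{RTD}(\mathcal{C})=\mathrm{TD}_{min}(\mathcal{C})$ if $\mathcal{C}=\mathcal{C}_{min}$, otherwise $\max\{\mathrm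{TD}_{min}(\mathcal{C}),\mathrm{RTD}(\mathcal{C}\setminus\mathcal{C}_{min})\}$.
   Formalization: Part (1) is stated for trees with at least two vertices: for the one-vertex tree the claim is false, since it has no degree-1 vertex (so ℓ = 0) while the class {∅, {v}} has RTD 1. *)

theory Defs
  imports "Graph_Theory.Digraph_Component"
begin

text \<open>
  A finite simple undirected graph is a symmetric digraph in the sense of the locale
  \<^locale>\<open>graph\<close> (finite, loop-free, without parallel arcs, symmetric): every undirected edge
  is a pair of opposite arcs. The degree of a vertex is therefore its out-degree, and the
  connected components are the strong components \<^const>\<open>pre_digraph.sccs\<close>.
\<close>

definition connected_sets :: "('a, 'b) pre_digraph \<Rightarrow> 'a set set" where
  "connected_sets G =
     insert {} {X. X \<subseteq> verts G \<and> X \<noteq> {} \<and> Digraph_Component.connected (G \<restriction> X)}"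

definition leaves :: "('a, 'b) pre_digraph \<Rightarrow> 'a set" where
  "leaves G = {v \<in> verts G. out_degree G v = 1}"

text \<open>
  The library predicates \<^const>\<open>tree\<close> and \<^const>\<open>spanning_tree\<close> forbid all directed cycles,
  hence also the closed walk that uses an edge back and forth; no symmetric digraph with an arc
  satisfies them. In a simple symmetric digraph the undirected cycles are exactly the directed
  cycles of length at least 3.
\<close>

definition graph_tree :: "('a, 'b) pre_digraph \<Rightarrow> bool" where
  "graph_tree T \<longleftrightarrow>
     graph T \<and> Digraph_Component.connected T \<and> \<not> (\<exists>p. pre_digraph.cycle T p \<and> 3 \<le> length p)"

definition graph_spanning_tree :: "('a, 'b) pre_digraph \<Rightarrow> ('a, 'b) pre_digraph \<Rightarrow> bool" where
  "graph_spanning_tree T G \<longleftrightarrow> graph_tree T \<and> spanning T G"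

text \<open>Meaningful for a connected finite graph, which has at least one spanning tree.\<close>

definition max_leaf :: "('a, 'b) pre_digraph \<Rightarrow> nat" where
  "max_leaf G = Max {card (leaves T) | T. graph_spanning_tree T G}"

text \<open>
  The supremum of a finite nonempty set of naturals is its maximum; it is 0 for the empty set,
  which occurs only for the graph without vertices.
\<close>

definition ell :: "('a, 'b) pre_digraph \<Rightarrow> nat" where
  "ell G = (SUP H \<in> pre_digraph.sccs G. max_leaf H)"

definition teaching_set :: "'x set \<Rightarrow> 'x set set \<Rightarrow> 'x set \<Rightarrow> 'x set \<Rightarrow> bool" where
  "teaching_set X \<C> C D \<longleftrightarrow>
     finite D \<and> D \<subseteq> X \<and> (\<forall>C' \<in> \<C> - {C}. \<exists>x \<in> D. x \<in> C \<longleftrightarrow> x \<notin> C')"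

definition TD :: "'x set \<Rightarrow> 'x set set \<Rightarrow> 'x set \<Rightarrow> nat" where
  "TD X \<C> C = (LEAST k. \<exists>D. teaching_set X \<C> C D \<and> card D = k)"

definition TD_min :: "'x set \<Rightarrow> 'x set set \<Rightarrow> nat" where
  "TD_min X \<C> = Min (TD X \<C> ` \<C>)"

definition C_min :: "'x set \<Rightarrow> 'x set set \<Rightarrow> 'x set set" where
  "C_min X \<C> = {C \<in> \<C>. TD X \<C> C = TD_min X \<C>}"

lemma C_min_subset: "C_min X \<C> \<subseteq> \<C>"
  by (auto simp: C_min_def)

lemma C_min_nonempty:
  assumes "finite \<C>" "\<C> \<noteq> {}"
  shows "C_min X \<C> \<noteq> {}"
proof -
  have "TD_min X \<C> \<in> TD X \<C> ` \<C>"
    unfolding TD_min_def using assms by (intro Min_in) auto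
  then show ?thesis by (auto simp: C_min_def)
qed

text \<open>
  The first case only makes the function total: the recursion preserves finiteness, and it is
  never entered with the empty class, since it stops when \<open>\<C> = C_min X \<C>\<close>.
\<close>

function RTD :: "'x set \<Rightarrow> 'x set set \<Rightarrow> nat" where
  "RTD X \<C> =
     (if infinite \<C> \<or> \<C> = {} then 0
      else if \<C> = C_min X \<C> then TD_min X \<C>
      else max (TD_min X \<C>) (RTD X (\<C> - C_min X \<C>)))"
  by pat_completeness auto
termination
proof (relation "measure (\<lambda>(X, \<C>). card \<C>)")
  fix X :: "'x set" and \<C> :: "'x set set"
  assume "\<not> (infinite \<C> \<or> \<C> = {})"
  then have "finite \<C>" "\<C> - C_min X \<C> \<subset> \<C>"
    using C_min_nonempty[of \<C> X] C_min_subset[of X \<C>] by auto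
  then show "((X, \<C> - C_min X \<C>), X, \<C>) \<in> measure (\<lambda>(X, \<C>). card \<C>)"
    by (simp add: psubset_card_mono)
qed simp

declare RTD.simps [simp del]

end

theory Submission
  imports Defs
begin

text \<open>
  The recursive teaching dimension is the maximum, over the nonempty subclasses, of the smallest
  teaching set of a member.

  Deleting any set of leaves of a spanning tree leaves a connected set, so the class contains a cube
  on the leaves; in the cube every teaching set contains all leaves.

  In a tree, an inclusion-maximal member of a subclass is taught by labelling its leaves positively:
  the members containing these leaves contain the whole subtree, and a subtree has at most as many
  leaves as the tree. In a graph, an inclusion-minimal nonempty member is taught by one positive
  example and its outer boundary as negative examples: a connected set that meets it and
  avoids the boundary lies inside it. The boundary has at most \<open>ell G\<close> vertices, because
  a connected set extends to a connected dominating set without shrinking the boundary, and the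
  vertices outside a dominating set can be attached as leaves to a spanning tree of it.
\<close>

section \<open>Recursive teaching dimension\<close>

lemma TD_attained:
  assumes "finite X" "\<C> \<subseteq> Pow X" "C \<in> \<C>"
  obtains D where "teaching_set X \<C> C D" "card D = TD X \<C> C"
proof -
  have "teaching_set X \<C> C X"
    using assms unfolding teaching_set_def by blast
  then have "\<exists>k D. teaching_set X \<C> C D \<and> card D = k" by blast
  from LeastI_ex[OF this] show ?thesis
    using that unfolding TD_def by blast
qed

lemma TD_le: "teaching_set X \<C> C D \<Longrightarrow> TD X \<C> C \<le> card D"
  unfolding TD_def by (rule Least_le) blast

lemma TD_min_le: "finite \<C> \<Longrightarrow> C \<in> \<C> \<Longrightarrow> TD_min X \<C> \<le> TD X \<C> C"
  unfolding TD_min_def by simp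

lemma RTD_cases:
  assumes "finite \<C>" "\<C> \<noteq> {}"
  shows "RTD X \<C> = (if \<C> = C_min X \<C> then TD_min X \<C>
    else max (TD_min X \<C>) (RTD X (\<C> - C_min X \<C>)))"
  using assms by (subst RTD.simps) simp

text \<open>Consider the first stage of the recursion that removes a member of \<open>\<D>\<close>.
  All of \<open>\<D>\<close> is still present there, so an optimal teaching set of that member also
  teaches it within \<open>\<D>\<close>, and \<open>TD_min\<close> of this stage is at least
  \<open>k\<close>.\<close>

lemma RTD_ge:
  assumes "finite X" "\<C> \<subseteq> Pow X" "\<D> \<subseteq> \<C>" "\<D> \<noteq> {}"
    and "\<And>C D. C \<in> \<D> \<Longrightarrow> teaching_set X \<D> C D \<Longrightarrow> k \<le> card D"
  shows "k \<le> RTD X \<C>"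
proof -
  have "finite \<C>" using assms(1,2) by (meson finite_Pow_iff finite_subset)
  then show ?thesis using assms(2,3)
  proof (induction "card \<C>" arbitrary: \<C> rule: less_induct)
    case less
    have ne: "\<C> \<noteq> {}" using less.prems assms(4) by blast
    note R = RTD_cases[OF less.prems(1) ne, of X]
    show ?case
    proof (cases "\<D> \<inter> C_min X \<C> = {}")
      case True
      have sub: "\<C> - C_min X \<C> \<subset> \<C>"
        using C_min_nonempty[OF less.prems(1) ne, of X] C_min_subset[of X \<C>] by blast
      have "k \<le> RTD X (\<C> - C_min X \<C>)"
        by (rule less.hyps) (use sub less.prems True in \<open>auto simp: psubset_card_mono\<close>)
      moreover have "\<C> \<noteq> C_min X \<C>" using True less.prems assms(4) by blast
      ultimately show ?thesis using R by simp
    next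
      case False
      then obtain C where C: "C \<in> \<D>" "C \<in> \<C>" "TD X \<C> C = TD_min X \<C>"
        by (auto simp: C_min_def)
      obtain D where D: "teaching_set X \<C> C D" "card D = TD X \<C> C"
        using TD_attained[OF assms(1) less.prems(2) C(2)] .
      have "teaching_set X \<D> C D"
        using D(1) less.prems(3) unfolding teaching_set_def by blast
      then have "k \<le> TD_min X \<C>" using assms(5) C(1,3) D(2) by metis
      then show ?thesis using R by (simp split: if_splits)
    qed
  qed
qed

text \<open>Each stage of the recursion runs on a nonempty subclass of \<open>\<C>\<close>, so every
  \<open>TD_min\<close> that enters the maximum is at most \<open>k\<close>.\<close>

lemma RTD_le:
  assumes "finite X" "\<C> \<subseteq> Pow X"
    and "\<And>\<D>. \<D> \<subseteq> \<C> \<Longrightarrow> \<D> \<noteq> {} \<Longrightarrow> \<exists>C\<in>\<D>. \<exists>D. teaching_set X \<D> C D \<and> card D \<le> k"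
  shows "RTD X \<C> \<le> k"
proof -
  have "finite \<C>" using assms(1,2) by (meson finite_Pow_iff finite_subset)
  then show ?thesis using assms(2,3)
  proof (induction "card \<C>" arbitrary: \<C> rule: less_induct)
    case less
    show ?case
    proof (cases "\<C> = {}")
      case True
      then show ?thesis by (simp add: RTD.simps)
    next
      case ne: False
      obtain C D where C: "C \<in> \<C>" "teaching_set X \<C> C D" "card D \<le> k"
        using less.prems(3)[OF order_refl ne] by blast
      have "TD_min X \<C> \<le> k"
        using TD_min_le[OF less.prems(1) C(1), of X] TD_le[OF C(2)] C(3) by linarith
      moreover have "RTD X (\<C> - C_min X \<C>) \<le> k"
      proof (rule less.hyps)
        show "card (\<C> - C_min X \<C>) < card \<C>"
          using C_min_nonempty[OF less.prems(1) ne, of X] C_min_subset[of X \<C>] less.prems(1)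
          by (intro psubset_card_mono) auto
        show "\<exists>C\<in>\<D>. \<exists>D. teaching_set X \<D> C D \<and> card D \<le> k"
          if "\<D> \<subseteq> \<C> - C_min X \<C>" "\<D> \<noteq> {}" for \<D>
          using less.prems(3) that by blast
      qed (use less.prems in auto)
      ultimately show ?thesis using RTD_cases[OF less.prems(1) ne, of X] by simp
    qed
  qed
qed

text \<open>For each element of \<open>L\<close>, every member of the cube has a partner that
  differs from it in this element only; hence each teaching set within the cube contains all of
  \<open>L\<close>.\<close>

lemma RTD_ge_cube:
  assumes "finite X" "\<C> \<subseteq> Pow X" "L \<subseteq> V" "\<And>S. S \<subseteq> L \<Longrightarrow> V - S \<in> \<C>"
  shows "card L \<le> RTD X \<C>"
proof (rule RTD_ge[OF assms(1,2), of "(\<lambda>S. V - S) ` Pow L"])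
  fix C D
  assume "C \<in> (\<lambda>S. V - S) ` Pow L" and D: "teaching_set X ((\<lambda>S. V - S) ` Pow L) C D"
  then obtain S where S: "S \<subseteq> L" "C = V - S" by blast
  have "L \<subseteq> D"
  proof
    fix x assume x: "x \<in> L"
    \<comment> \<open>The neighbour of \<open>S\<close> in direction \<open>x\<close>:
      \<open>V - S\<close> and \<open>V - S'\<close> differ exactly at \<open>x\<close>.\<close>
    define S' where "S' = (if x \<in> S then S - {x} else insert x S)"
    have S': "S' \<subseteq> L" using x S unfolding S'_def by auto
    have "V - S' \<noteq> C" using x S assms(3) unfolding S'_def by (auto split: if_splits)
    then obtain y where y: "y \<in> D" "y \<in> C \<longleftrightarrow> y \<notin> V - S'"
      using D S' unfolding teaching_set_def by blast
    then have "y = x" using S unfolding S'_def by (auto split: if_splits)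
    then show "x \<in> D" using y by simp
  qed
  then show "card L \<le> card D"
    using D card_mono unfolding teaching_set_def by blast
qed (use assms(4) in auto)

section \<open>Connected vertex sets of a symmetric relation\<close>

text \<open>Connectedness is phrased on a bare relation, so that edge sets of a graph and of its
  subgraphs can be compared on the same vertices. The empty set counts as connected, in line with
  \<open>connected_sets\<close>.\<close>

definition conn :: "('a \<times> 'a) set \<Rightarrow> 'a set \<Rightarrow> bool" where
  "conn E X \<longleftrightarrow> (\<forall>u\<in>X. \<forall>v\<in>X. (u, v) \<in> (Restr E X)\<^sup>*)"

lemma connI: "(\<And>u v. u \<in> X \<Longrightarrow> v \<in> X \<Longrightarrow> (u, v) \<in> (Restr E X)\<^sup>*) \<Longrightarrow> conn E X"
  unfolding conn_def by blast

lemma connD: "conn E X \<Longrightarrow> u \<in> X \<Longrightarrow> v \<in> X \<Longrightarrow> (u, v) \<in> (Restr E X)\<^sup>*"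
  unfolding conn_def by blast

lemma conn_empty [simp]: "conn E {}" and conn_singleton [simp]: "conn E {x}"
  unfolding conn_def by auto

lemma conn_Restr_cong: "Restr E X = Restr F X \<Longrightarrow> conn E X \<longleftrightarrow> conn F X"
  unfolding conn_def by simp

lemma conn_mono:
  assumes "E \<subseteq> F" "conn E X" shows "conn F X"
proof -
  have "(Restr E X)\<^sup>* \<subseteq> (Restr F X)\<^sup>*" using assms(1) by (intro rtrancl_mono) blast
  then show ?thesis using assms(2) unfolding conn_def by blast
qed

lemma conn_insert:
  assumes "sym E" "conn E X" "a \<in> X" "(a, v) \<in> E"
  shows "conn E (insert v X)"
proof (rule connI)
  let ?R = "(Restr E (insert v X))\<^sup>*"
  have sub: "(Restr E X)\<^sup>* \<subseteq> ?R" by (intro rtrancl_mono) blast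
  have av: "(a, v) \<in> ?R" "(v, a) \<in> ?R"
    using assms(1,3,4) by (auto dest: symD)
  have "(u, a) \<in> ?R" "(a, u) \<in> ?R" if "u \<in> insert v X" for u
    using that av connD[OF assms(2)] assms(3) sub by auto
  then show "(u, w) \<in> ?R" if "u \<in> insert v X" "w \<in> insert v X" for u w
    using that by (meson rtrancl_trans)
qed

lemma conn_remove_leaf:
  assumes "sym E" "irrefl E" "conn E X"
    and leaf: "\<And>a b. a \<in> X \<Longrightarrow> b \<in> X \<Longrightarrow> (v, a) \<in> E \<Longrightarrow> (v, b) \<in> E \<Longrightarrow> a = b"
  shows "conn E (X - {v})"
proof (rule connI)
  fix u w assume u: "u \<in> X - {v}" and w: "w \<in> X - {v}"
  let ?R = "(Restr E (X - {v}))\<^sup>*"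
  \<comment> \<open>At \<open>y = v\<close> the walk must turn back to the neighbour it came from.\<close>
  have "(y \<noteq> v \<longrightarrow> (u, y) \<in> ?R) \<and> (y = v \<longrightarrow> (\<forall>a\<in>X. (v, a) \<in> E \<longrightarrow> (u, a) \<in> ?R))"
    if "(u, y) \<in> (Restr E X)\<^sup>*" for y
    using that
  proof induction
    case base
    then show ?case using u by auto
  next
    case (step y z)
    have yz: "(y, z) \<in> E" "(z, y) \<in> E" "y \<in> X" "z \<in> X"
      using step.hyps(2) assms(1) by (auto dest: symD)
    then have "y \<noteq> z" using assms(2) by (auto simp: irrefl_def)
    consider "y \<noteq> v" "z \<noteq> v" | "y \<noteq> v" "z = v" | "y = v" "z \<noteq> v"
      using \<open>y \<noteq> z\<close> by blast
    then show ?case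
    proof cases
      case 1
      then show ?thesis using step.IH yz by (auto intro: rtrancl_into_rtrancl)
    next
      case 2
      then show ?thesis using step.IH yz leaf by auto
    next
      case 3
      then show ?thesis using step.IH yz by auto
    qed
  qed
  then show "(u, w) \<in> ?R" using connD[OF assms(3)] u w by blast
qed

text \<open>A walk inside \<open>C\<close> from \<open>X\<close> to \<open>C - X\<close> has to
  cross over by some edge.\<close>

lemma conn_exit:
  assumes "conn E C" "X \<subset> C" "X \<noteq> {}"
  obtains a v where "a \<in> X" "v \<in> C - X" "(a, v) \<in> E"
proof -
  obtain x y where xy: "x \<in> X" "y \<in> C - X" using assms by blast
  have "\<exists>a\<in>X. \<exists>v\<in>C - X. (a, v) \<in> E"
  proof (rule ccontr)
    assume no: "\<not> ?thesis"
    have "z \<in> X" if "(x, z) \<in> (Restr E C)\<^sup>*" for z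
      using that by induction (use xy no in auto)
    then show False using connD[OF assms(1)] xy assms(2) by blast
  qed
  then show ?thesis using that by blast
qed

text \<open>An induction principle: \<open>C\<close> is reached from \<open>X0\<close> by attaching
  one adjacent vertex at a time. \<open>conn_exit\<close> supplies the next vertex and
  \<open>conn_insert\<close> keeps the set connected.\<close>

lemma conn_grow [consumes 6, case_names base step]:
  assumes "sym E" "finite C" "conn E C" "X0 \<subseteq> C" "X0 \<noteq> {}" "conn E X0"
    and "P X0"
    and step: "\<And>X a v. X0 \<subseteq> X \<Longrightarrow> X \<subseteq> C \<Longrightarrow> conn E X \<Longrightarrow> P X \<Longrightarrow> a \<in> X \<Longrightarrow> v \<in> C - X
      \<Longrightarrow> (a, v) \<in> E \<Longrightarrow> P (insert v X)"
  shows "P C"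
proof -
  have "P C" if "X0 \<subseteq> X" "X \<subseteq> C" "conn E X" "P X" for X
    using that
  proof (induction "card (C - X)" arbitrary: X rule: less_induct)
    case less
    show ?case
    proof (cases "X = C")
      case True
      then show ?thesis using less.prems by simp
    next
      case False
      then obtain a v where av: "a \<in> X" "v \<in> C - X" "(a, v) \<in> E"
        using conn_exit[OF assms(3)] less.prems assms(5) by (metis psubsetI subset_empty)
      have "card (C - insert v X) < card (C - X)"
        using av assms(2) by (intro psubset_card_mono) auto
      then show ?thesis
        using less.hyps[of "insert v X"] less.prems av
          conn_insert[OF assms(1) less.prems(3) av(1,3)] step[OF less.prems av]
        by auto
    qed
  qed
  then show ?thesis using assms by blast
qed

section \<open>Acyclic relations\<close>

text \<open>
  For a symmetric relation this is equivalent to the absence of cycles of length at least 3.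
\<close>

definition acyc :: "('a \<times> 'a) set \<Rightarrow> bool" where
  "acyc E \<longleftrightarrow> (\<forall>X v a b. conn E X \<longrightarrow> v \<notin> X \<longrightarrow> a \<in> X \<longrightarrow> b \<in> X \<longrightarrow>
    (v, a) \<in> E \<longrightarrow> (v, b) \<in> E \<longrightarrow> a = b)"

lemma acycD:
  "acyc E \<Longrightarrow> conn E X \<Longrightarrow> v \<notin> X \<Longrightarrow> a \<in> X \<Longrightarrow> b \<in> X \<Longrightarrow> (v, a) \<in> E \<Longrightarrow> (v, b) \<in> E \<Longrightarrow> a = b"
  unfolding acyc_def by blast

section \<open>Ends of connected sets in an acyclic relation\<close>

text \<open>Degree at most 1 inside \<open>X\<close>, rather than exactly 1: the vertex of a
  singleton then counts as an end, which starts the inductions that grow a set from one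
  vertex.\<close>

definition ends :: "('a \<times> 'a) set \<Rightarrow> 'a set \<Rightarrow> 'a set" where
  "ends E X = {v \<in> X. \<forall>a\<in>X. \<forall>b\<in>X. (v, a) \<in> E \<longrightarrow> (v, b) \<in> E \<longrightarrow> a = b}"

text \<open>By acyclicity \<open>a\<close> is the only neighbour of \<open>v\<close> in
  \<open>X\<close>. So \<open>v\<close> is an end of the larger set, and \<open>a\<close> is the
  only old vertex whose degree changes.\<close>

lemma ends_insert:
  assumes "sym E" "irrefl E" "acyc E" "conn E X" "a \<in> X" "v \<notin> X" "(a, v) \<in> E"
  shows "insert v (ends E X - {a}) \<subseteq> ends E (insert v X)"
proof -
  have va: "(v, a) \<in> E" using assms(1,7) by (auto dest: symD)
  have uniq: "w = a" if "w \<in> X" "(w, v) \<in> E \<or> (v, w) \<in> E" for w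
    using acycD[OF assms(3,4,6) that(1) assms(5) _ va] that(2) assms(1) by (auto dest: symD)
  have "(v, v) \<notin> E" using assms(2) by (auto simp: irrefl_def)
  then show ?thesis unfolding ends_def using uniq by blast
qed

text \<open>While \<open>C\<close> grows to \<open>V\<close>, each new vertex is an end and costs at
  most one old end.\<close>

lemma card_ends_mono:
  assumes "sym E" "irrefl E" "acyc E" "finite V" "conn E V" "C \<subseteq> V" "C \<noteq> {}" "conn E C"
  shows "card (ends E C) \<le> card (ends E V)"
  using assms(1,4,5,6,7,8)
proof (induction rule: conn_grow)
  case (step X a v)
  have fin: "finite X" using step.hyps assms(4) finite_subset by blast
  have finE: "finite (ends E X)" "finite (ends E (insert v X))"
    using fin unfolding ends_def by auto
  have "v \<notin> ends E X" using step.hyps unfolding ends_def by auto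
  then have "card (ends E X) \<le> card (insert v (ends E X - {a}))"
    using finE card_Suc_Diff1[of "ends E X" a] by (cases "a \<in> ends E X") auto
  also have "\<dots> \<le> card (ends E (insert v X))"
    using ends_insert[OF assms(1-3)] step.hyps finE by (intro card_mono) auto
  finally show ?case using step.IH by linarith
qed simp

text \<open>Grow \<open>C\<close> from one vertex; let \<open>v\<close> be attached at
  \<open>a\<close>. If \<open>a\<close> lies in \<open>Y\<close>, the induction hypothesis applies
  to \<open>Y\<close>. Otherwise it applies to \<open>insert a Y\<close>, so \<open>Y\<close>
  contains a neighbour \<open>b\<close> of \<open>a\<close> in \<open>X\<close>; then
  \<open>a\<close>, outside the connected set \<open>Y\<close>, has the two neighbours
  \<open>v\<close> and \<open>b\<close> in it, against acyclicity.\<close>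

lemma ends_hull:
  assumes "sym E" "irrefl E" "acyc E" "finite C" "conn E C" "conn E Y" "ends E C \<subseteq> Y"
  shows "C \<subseteq> Y"
proof (cases "C = {}")
  case False
  then obtain r where r: "{r} \<subseteq> C" by blast
  have "\<forall>Y. conn E Y \<longrightarrow> ends E C \<subseteq> Y \<longrightarrow> C \<subseteq> Y"
    using assms(1,4,5) r insert_not_empty[of r "{}"] conn_singleton
  proof (induction rule: conn_grow)
    case base
    have "r \<in> ends E {r}" by (auto simp: ends_def)
    then show ?case by blast
  next
    case (step X a v)
    have v: "v \<notin> X" and va: "(v, a) \<in> E"
      using step.hyps assms(1) by (auto dest: symD)
    have sub: "insert v (ends E X - {a}) \<subseteq> ends E (insert v X)"
      using ends_insert[OF assms(1-3)] step.hyps by auto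
    show ?case
    proof (intro allI impI)
      fix Y assume Y: "conn E Y" "ends E (insert v X) \<subseteq> Y"
      have vY: "v \<in> Y" using sub Y by blast
      show "insert v X \<subseteq> Y"
      proof (cases "a \<in> Y")
        case True
        then have "ends E X \<subseteq> Y" using sub Y by blast
        then show ?thesis using step.IH Y vY by blast
      next
        case False
        \<comment> \<open>If \<open>X = {a}\<close>, both \<open>a\<close> and \<open>v\<close> are
          ends, so \<open>a\<close> would lie in \<open>Y\<close>. Hence \<open>a\<close> has a
          second neighbour, inside \<open>X\<close>.\<close>
        have "X \<noteq> {a}"
        proof
          assume "X = {a}"
          then have "a \<in> ends E (insert v X)"
            using assms(2) by (auto simp: ends_def irrefl_def)
          then show False using Y False by blast
        qed
        then have "{a} \<subset> X" using step.hyps by blast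
        then obtain a' b where "a' \<in> {a}" "b \<in> X - {a}" "(a', b) \<in> E"
          by (rule conn_exit[OF step.hyps(3) _ insert_not_empty])
        then have b: "b \<in> X - {a}" "(a, b) \<in> E" by simp_all
        have "conn E (insert a Y)" by (rule conn_insert[OF assms(1) Y(1) vY va])
        moreover have "ends E X \<subseteq> insert a Y" using sub Y by blast
        ultimately have "X \<subseteq> insert a Y" using step.IH by blast
        then have "b \<in> Y" using b by blast
        then have "v = b"
          using acycD[OF assms(3) Y(1) False vY _ step.hyps(6)] b by blast
        then show ?thesis using b v by blast
      qed
    qed
  qed
  then show ?thesis using assms by blast
qed simp

section \<open>Trees as edge relations\<close>

definition tree_on :: "'a set \<Rightarrow> ('a \<times> 'a) set \<Rightarrow> bool" where
  "tree_on X F \<longleftrightarrow> F \<subseteq> X \<times> X \<and> sym F \<and> irrefl F \<and> conn F X \<and> acyc F"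

lemma tree_on_singleton: "tree_on {r} {}"
  by (auto simp: tree_on_def acyc_def sym_def irrefl_def)

lemma tree_on_insert:
  assumes "tree_on X F" "a \<in> X" "v \<notin> X"
  shows "tree_on (insert v X) (insert (a, v) (insert (v, a) F))" (is "tree_on _ ?F")
proof -
  have F: "F \<subseteq> X \<times> X" "sym F" "irrefl F" "conn F X" "acyc F"
    using assms(1) unfolding tree_on_def by auto
  have sym: "sym ?F" using F(2) by (auto simp: sym_def)
  have irr: "irrefl ?F" using F(3) assms(2,3) by (auto simp: irrefl_def)
  have nv: "(v, w) \<in> ?F \<longleftrightarrow> w = a" "(w, v) \<in> ?F \<longleftrightarrow> w = a" for w
    using F(1) assms(2,3) by auto
  have restr: "conn F Y" if "conn ?F Y" "v \<notin> Y" for Y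
    using that by (subst conn_Restr_cong[of F Y ?F]) auto
  have "acyc ?F"
    unfolding acyc_def
  proof (intro allI impI)
    fix Y w c d
    assume Y: "conn ?F Y" "w \<notin> Y" "c \<in> Y" "d \<in> Y" "(w, c) \<in> ?F" "(w, d) \<in> ?F"
    show "c = d"
    proof (cases "w = v")
      case True
      then show ?thesis using Y(5,6) nv by simp
    next
      case wv: False
      show ?thesis
      proof (cases "v \<in> {c, d}")
        case True
        then have "w = a" using Y(5,6) nv by auto
        then have "Y = {v}"
          using conn_exit[OF Y(1), of "{v}"] True nv Y(2-4) by (metis DiffD1 empty_iff
              empty_subsetI insert_iff insert_subset psubsetI singletonD)
        then show ?thesis using Y by simp
      next
        case False
        have "conn ?F (Y - {v})"
          by (rule conn_remove_leaf[OF sym irr Y(1)]) (simp only: nv)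
        then have "conn F (Y - {v})" by (rule restr) simp
        then show ?thesis
          by (rule acycD[OF F(5), of _ w]) (use Y False wv in auto)
      qed
    qed
  qed
  moreover have "conn ?F (insert v X)"
    using F(4) by (intro conn_insert[OF sym _ assms(2)]) (auto intro: conn_mono)
  ultimately show ?thesis
    using sym irr F(1) assms(2) unfolding tree_on_def by auto
qed

lemma tree_on_exists:
  assumes "sym E" "finite X" "X \<noteq> {}" "conn E X"
  shows "\<exists>F\<subseteq>E. tree_on X F"
proof -
  obtain r where r: "{r} \<subseteq> X" using assms by blast
  show ?thesis
    using assms(1,2,4) r insert_not_empty[of r "{}"] conn_singleton
  proof (induction rule: conn_grow)
    case base
    show ?case by (intro exI[of _ "{}"]) (simp add: tree_on_singleton)
  next
    case (step X a v)
    then obtain F where F: "F \<subseteq> E" "tree_on X F" by blast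
    have "(v, a) \<in> E" using assms(1) step.hyps by (auto dest: symD)
    then show ?case
      using tree_on_insert[OF F(2), of a v] F(1) step.hyps
      by (intro exI[of _ "insert (a, v) (insert (v, a) F)"]) auto
  qed
qed

text \<open>Every vertex of \<open>B\<close> is hung on a vertex of \<open>A\<close>, never on
  another vertex of \<open>B\<close>, so a later attachment leaves the degree of the earlier ones at
  1.\<close>

lemma tree_on_attach:
  assumes "sym E" "finite B" "A \<inter> B = {}" "\<And>v. v \<in> B \<Longrightarrow> \<exists>a\<in>A. (a, v) \<in> E"
    and "F0 \<subseteq> E" "tree_on A F0"
  shows "\<exists>F\<subseteq>E. tree_on (A \<union> B) F \<and> (\<forall>v\<in>B. card (F `` {v}) = 1)"
  using assms(2-4)
proof (induction B rule: finite_induct)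
  case empty
  then show ?case using assms by auto
next
  case (insert v B)
  then obtain F where F: "F \<subseteq> E" "tree_on (A \<union> B) F" "\<And>w. w \<in> B \<Longrightarrow> card (F `` {w}) = 1"
    by auto
  obtain a where a: "a \<in> A" "(a, v) \<in> E" using insert.prems by blast
  let ?F = "insert (a, v) (insert (v, a) F)"
  have v: "v \<notin> A \<union> B" using insert by auto
  have "tree_on (insert v (A \<union> B)) ?F"
    using tree_on_insert[OF F(2) _ v] a by simp
  moreover have "?F \<subseteq> E" using F(1) a assms(1) by (auto dest: symD)
  moreover have "?F `` {v} = {a}" using F(2) v unfolding tree_on_def by auto
  moreover have "?F `` {w} = F `` {w}" if "w \<in> B" for w
    using that a v insert.prems by auto
  ultimately show ?case
    using F(3) by (intro exI[of _ ?F]) auto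
qed

section \<open>Boundaries and connected dominating sets\<close>

definition boundary :: "('a \<times> 'a) set \<Rightarrow> 'a set \<Rightarrow> 'a set" where
  "boundary E X = E `` X - X"

text \<open>Choose \<open>A\<close> of maximal size among the connected supersets of
  \<open>C\<close> in \<open>W\<close> with boundary at least as large as that of \<open>C\<close>.
  If \<open>A\<close> did not dominate \<open>W\<close>, some boundary vertex \<open>b\<close> would
  have a neighbour \<open>v\<close> beyond the boundary; moving \<open>b\<close> into
  \<open>A\<close> trades \<open>b\<close> for \<open>v\<close> in the boundary and contradicts
  maximality.\<close>

lemma dominating_extension:
  assumes "sym E" "E \<subseteq> W \<times> W" "finite W" "conn E W" "conn E C" "C \<noteq> {}" "C \<subseteq> W"
  obtains A where "conn E A" "C \<subseteq> A" "A \<subseteq> W" "boundary E A = W - A"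
    "card (boundary E C) \<le> card (boundary E A)"
proof -
  define P where "P A \<longleftrightarrow> conn E A \<and> C \<subseteq> A \<and> A \<subseteq> W \<and>
    card (boundary E C) \<le> card (boundary E A)" for A
  have "P C" using assms by (simp add: P_def)
  moreover have "\<forall>A. P A \<longrightarrow> card A \<le> card W"
    using assms(3) by (auto simp: P_def card_mono)
  ultimately obtain A where A: "P A" and max: "\<And>A'. P A' \<Longrightarrow> card A' \<le> card A"
    using ex_has_greatest_nat[of P C card "Suc (card W)"] by (metis less_Suc_eq_le)
  have bW: "boundary E X \<subseteq> W" for X using assms(2) unfolding boundary_def by auto
  have "A \<union> boundary E A = W"
  proof (rule ccontr)
    assume "A \<union> boundary E A \<noteq> W"
    then have "A \<union> boundary E A \<subset> W" using A bW by (auto simp: P_def)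
    moreover have "A \<union> boundary E A \<noteq> {}" using A assms(6) by (auto simp: P_def)
    ultimately obtain b v where b: "b \<in> A \<union> boundary E A" "v \<in> W - (A \<union> boundary E A)"
      "(b, v) \<in> E"
      using conn_exit[OF assms(4)] by metis
    have bA: "b \<in> boundary E A" "b \<notin> A" using b unfolding boundary_def by auto
    then obtain a where a: "a \<in> A" "(a, b) \<in> E" unfolding boundary_def by blast
    have finb: "finite (boundary E X)" for X using bW assms(3) finite_subset by blast
    have sub: "insert v (boundary E A - {b}) \<subseteq> boundary E (insert b A)"
      using b bA unfolding boundary_def by auto
    have "card (boundary E A) \<le> card (insert v (boundary E A - {b}))"
      using b finb bA card_Suc_Diff1[of "boundary E A" b] by simp
    also have "\<dots> \<le> card (boundary E (insert b A))"
      using sub finb by (intro card_mono) auto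
    finally have "P (insert b A)"
      using A conn_insert[OF assms(1) _ a] bA bW by (auto simp: P_def)
    then have "card (insert b A) \<le> card A" by (rule max)
    moreover have "finite A" using A assms(3) finite_subset unfolding P_def by blast
    ultimately show False using bA by simp
  qed
  moreover have "A \<inter> boundary E A = {}" unfolding boundary_def by blast
  ultimately have "boundary E A = W - A" by blast
  then show ?thesis using that A by (auto simp: P_def)
qed

section \<open>Symmetric digraphs\<close>

lemma arcs_ends_induce: "arcs_ends (G \<restriction> X) = Restr (arcs_ends G) X"
  by (auto simp: arcs_ends_conv)

text \<open>The library defines connectedness through the symmetric closure, which for a symmetric
  digraph is the arc relation itself.\<close>

lemma connected_iff_conn:
  assumes "wf_digraph G" "symmetric G"
  shows "Digraph_Component.connected G \<longleftrightarrow> verts G \<noteq> {} \<and> conn (arcs_ends G) (verts G)"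
proof -
  interpret wf_digraph G by (rule assms)
  have "symcl (arcs_ends G) = arcs_ends G"
    using assms(2) unfolding symcl_def symmetric_def by (auto dest: symD)
  moreover have "Restr (arcs_ends G) (verts G) = arcs_ends G"
    by (auto simp: arcs_ends_conv)
  moreover have "(u, v) \<in> rtrancl_on (verts G) (arcs_ends G) \<longleftrightarrow> (u, v) \<in> (arcs_ends G)\<^sup>*"
    if "u \<in> verts G" for u v
    using reachable_conv'[OF that] by (simp add: reachable_def)
  ultimately show ?thesis unfolding connected_conv conn_def by auto
qed

context graph
begin

lemma sym_arcs_ends: "sym (arcs_ends G)"
  using sym_arcs by (simp add: symmetric_def)

lemma irrefl_arcs_ends: "irrefl (arcs_ends G)"
  using no_loops by (auto simp: irrefl_def arcs_ends_conv)

lemma arcs_ends_in_verts: "arcs_ends G \<subseteq> verts G \<times> verts G"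
  by (auto simp: arcs_ends_conv)

lemma connected_induce_iff:
  "Digraph_Component.connected (G \<restriction> X) \<longleftrightarrow> X \<noteq> {} \<and> conn (arcs_ends G) X"
proof -
  have "symmetric (G \<restriction> X)"
    using sym_arcs_ends by (auto simp: symmetric_def arcs_ends_induce sym_def)
  then show ?thesis
    using connected_iff_conn[OF wellformed_induce_subgraph]
      conn_Restr_cong[of "Restr (arcs_ends G) X" X "arcs_ends G"]
    by (auto simp: arcs_ends_induce)
qed

lemma connected_sets_eq: "connected_sets G = {X. X \<subseteq> verts G \<and> conn (arcs_ends G) X}"
  unfolding connected_sets_def using connected_induce_iff by auto

lemma connected_iff: "Digraph_Component.connected G \<longleftrightarrow> verts G \<noteq> {} \<and> conn (arcs_ends G) (verts G)"
  using connected_iff_conn wf_digraph_axioms sym_arcs by blast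

lemma strongly_connected_imp_connected:
  assumes "strongly_connected G" shows "Digraph_Component.connected G"
  using assms reachable_mk_symmetricI unfolding connected_def strongly_connected_def by simp

section \<open>Acyclic relations versus cycles of the digraph\<close>

lemma conn_awalk_verts:
  assumes "awalk u p v" shows "conn (arcs_ends G) (set (awalk_verts u p))"
  using assms
proof (induction p arbitrary: u)
  case (Cons e p)
  then have p: "awalk (head G e) p v" "tail G e = u" "e \<in> arcs G"
    by (auto simp: awalk_Cons_iff)
  have "(head G e, u) \<in> arcs_ends G"
    using p sym_arcs_ends by (auto simp: arcs_ends_conv dest: symD)
  moreover have "head G e \<in> set (awalk_verts (head G e) p)"
    using p(1) by (rule hd_in_awalk_verts)
  ultimately show ?case
    using conn_insert[OF sym_arcs_ends Cons.IH[OF p(1)]] p(2) by simp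
qed simp

text \<open>Without its base point \<open>u\<close> the cycle is a walk \<open>q\<close> on a
  connected set that avoids \<open>u\<close>, and both of its end vertices are adjacent to
  \<open>u\<close>. Acyclicity makes these equal, although \<open>q\<close> is a nonempty
  path.\<close>

lemma acyc_imp_no_cycle:
  assumes "acyc (arcs_ends G)" "cycle p" shows "length p < 3"
proof (rule ccontr)
  assume len: "\<not> length p < 3"
  obtain u where u: "awalk u p u" "distinct (tl (awalk_verts u p))"
    using assms(2) unfolding cycle_def by blast
  \<comment> \<open>The cycle is split as \<open>e # q @ [f]\<close>; length at least 3 keeps
    \<open>q\<close> nonempty.\<close>
  obtain e p' where p': "p = e # p'" "length p' \<ge> 2" using len by (cases p) auto
  then have "p' \<noteq> []" by auto
  then obtain q f where q: "p' = q @ [f]" by (metis rev_exhaust)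
  let ?a = "head G e" and ?b = "tail G f"
  have w: "awalk ?a (q @ [f]) u" "tail G e = u" "e \<in> arcs G"
    using u(1) p'(1) q by (auto simp: awalk_Cons_iff)
  then have qw: "awalk ?a q ?b" and f: "f \<in> arcs G" "head G f = u"
    by (auto simp: awalk_Cons_iff awalk_Nil_iff)
  have "distinct (awalk_verts ?a (q @ [f]))" using u(2) p'(1) q by simp
  then have dist: "distinct (awalk_verts ?a q)" "u \<notin> set (awalk_verts ?a q)"
    using awalk_verts_append[OF w(1)] f qw by auto
  have "(u, ?a) \<in> arcs_ends G" "(?b, u) \<in> arcs_ends G"
    using w(2,3) f by (auto simp: arcs_ends_conv)
  moreover have "?a \<in> set (awalk_verts ?a q)" by (rule hd_in_awalk_verts(1)[OF qw])
  moreover have "last (awalk_verts ?a q) = ?b" using qw by blast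
  then have "?b \<in> set (awalk_verts ?a q)" using last_in_set[OF awalk_verts_non_Nil] by metis
  ultimately have "?a = ?b"
    using acycD[OF assms(1) conn_awalk_verts[OF qw] dist(2)] sym_arcs_ends by (meson symD)
  moreover have "q \<noteq> []" using p'(2) q by auto
  ultimately show False
    using qw dist(1) apath_nonempty_ends unfolding apath_def by metis
qed

text \<open>Two distinct neighbours \<open>a\<close> and \<open>b\<close> of \<open>v\<close> are
  joined by a path in \<open>X\<close>, which misses \<open>v\<close>. Closing it up through
  \<open>v\<close> gives a cycle with at least three arcs.\<close>

lemma no_cycle_imp_acyc:
  assumes "\<And>p. cycle p \<Longrightarrow> length p < 3" shows "acyc (arcs_ends G)"
  unfolding acyc_def
proof (intro allI impI, rule ccontr)
  fix X v a b
  assume X: "conn (arcs_ends G) X" "v \<notin> X" "a \<in> X" "b \<in> X"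
    and e: "(v, a) \<in> arcs_ends G" "(v, b) \<in> arcs_ends G" and ab: "a \<noteq> b"
  \<comment> \<open>\<open>X\<close> may contain elements that are not vertices; on \<open>Y\<close>
    the induced digraph is a subgraph of \<open>G\<close>, so its paths are paths of
    \<open>G\<close>.\<close>
  define Y where "Y = X \<inter> verts G"
  have "Restr (arcs_ends G) X = Restr (arcs_ends (G \<restriction> Y)) X"
    using arcs_ends_in_verts by (auto simp: arcs_ends_induce Y_def)
  then have "(a, b) \<in> (arcs_ends (G \<restriction> Y))\<^sup>*"
    using connD[OF X(1,3,4)] by (metis Int_lower1 rtrancl_mono subsetD)
  moreover interpret Y: wf_digraph "G \<restriction> Y" by (rule wellformed_induce_subgraph)
  have "a \<in> verts (G \<restriction> Y)"
    using X e arcs_ends_in_verts by (auto simp: Y_def)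
  ultimately have "a \<rightarrow>\<^sup>*\<^bsub>G \<restriction> Y\<^esub> b"
    using Y.reachable_conv' by blast
  then obtain q where q: "Y.apath a q b" using Y.reachable_apath by blast
  have qY: "set (awalk_verts a q) \<subseteq> Y"
    using q Y.awalk_conv[of a q b] unfolding Y.apath_def awalk_verts_induce by simp
  have "apath a q b"
    using subgraph_apath_imp_apath[OF q subgraph_induce_subgraphI] by (simp add: Y_def)
  then have q': "awalk a q b" "distinct (awalk_verts a q)" by (auto simp: apath_def)
  obtain e1 where e1: "e1 \<in> arcs G" "tail G e1 = v" "head G e1 = a"
    using e by (auto simp: arcs_ends_conv)
  have "(b, v) \<in> arcs_ends G" using graph_symmetric[OF e(2)] .
  then obtain e2 where e2: "e2 \<in> arcs G" "tail G e2 = b" "head G e2 = v"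
    by (auto simp: arcs_ends_conv)
  have "awalk a (q @ [e2]) v"
    using q' e2 by (auto simp: awalk_Cons_iff awalk_Nil_iff)
  moreover from this have "distinct (awalk_verts a (q @ [e2]))"
    using awalk_verts_append[of a q "[e2]" v] q' qY X(2) e2 by (auto simp: Y_def)
  ultimately have "cycle (e1 # q @ [e2])"
    unfolding cycle_def using e1 by (intro exI[of _ v]) (auto simp: awalk_Cons_iff)
  moreover have "q \<noteq> []" using q' ab by (auto simp: awalk_Nil_iff)
  ultimately show False using assms by (fastforce simp: neq_Nil_conv)
qed

text \<open>Nonemptiness appears separately because \<open>conn\<close> accepts the empty set, while
  a connected digraph has a vertex.\<close>

lemma graph_tree_iff: "graph_tree G \<longleftrightarrow> verts G \<noteq> {} \<and> tree_on (verts G) (arcs_ends G)"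
  unfolding graph_tree_def tree_on_def connected_iff
  using acyc_imp_no_cycle no_cycle_imp_acyc graph_axioms sym_arcs_ends irrefl_arcs_ends
    arcs_ends_in_verts by (metis not_less)

lemma out_degree_eq: "out_degree G v = card (arcs_ends G `` {v})"
proof -
  have "inj_on (head G) (out_arcs G v)"
    using no_multi_arcs by (auto simp: inj_on_def arc_to_ends_def)
  moreover have "head G ` out_arcs G v = arcs_ends G `` {v}"
    by (auto simp: arcs_ends_conv)
  ultimately show ?thesis unfolding out_degree_def by (metis card_image)
qed

lemma leaves_eq: "leaves G = {v \<in> verts G. card (arcs_ends G `` {v}) = 1}"
  unfolding leaves_def out_degree_eq ..

lemma leaves_subset_ends: "leaves G \<subseteq> ends (arcs_ends G) (verts G)"
proof
  fix v assume "v \<in> leaves G"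
  then obtain w where w: "v \<in> verts G" "arcs_ends G `` {v} = {w}"
    by (auto simp: leaves_eq card_1_singleton_iff)
  then have "a = b" if "(v, a) \<in> arcs_ends G" "(v, b) \<in> arcs_ends G" for a b
    using that by (metis Image_singleton_iff singletonD)
  then show "v \<in> ends (arcs_ends G) (verts G)"
    using w(1) unfolding ends_def by blast
qed

text \<open>With a second vertex, connectedness gives every end a neighbour. A one-vertex graph has
  one end and no leaf.\<close>

lemma ends_eq_leaves:
  assumes "2 \<le> card (verts G)" "conn (arcs_ends G) (verts G)"
  shows "ends (arcs_ends G) (verts G) = leaves G"
proof
  show "ends (arcs_ends G) (verts G) \<subseteq> leaves G"
  proof
    fix v assume v: "v \<in> ends (arcs_ends G) (verts G)"
    then have "v \<in> verts G" by (simp add: ends_def)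
    moreover have "verts G \<noteq> {v}" using assms(1) by auto
    ultimately obtain a where a: "(v, a) \<in> arcs_ends G"
      using conn_exit[OF assms(2), of "{v}"] by blast
    have "b = a" if "(v, b) \<in> arcs_ends G" for b
      using v a that arcs_ends_in_verts by (auto simp: ends_def)
    then have "arcs_ends G `` {v} = {a}" using a by blast
    then show "v \<in> leaves G" using \<open>v \<in> verts G\<close> by (simp add: leaves_eq)
  qed
qed (rule leaves_subset_ends)

section \<open>Spanning trees and the maximum number of leaves\<close>

text \<open>Keep all vertices of \<open>G\<close> and those arcs whose pair of end vertices lies in
  \<open>F\<close>; since \<open>F \<subseteq> arcs_ends G\<close>, the arc relation of the result
  is exactly \<open>F\<close>.\<close>

lemma spanning_tree_of_relation:
  assumes "F \<subseteq> arcs_ends G" "tree_on (verts G) F" "verts G \<noteq> {}"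
  obtains T where "graph_spanning_tree T G" "leaves T = {v \<in> verts G. card (F `` {v}) = 1}"
proof -
  define T where "T = \<lparr>verts = verts G, arcs = {e \<in> arcs G. arc_to_ends G e \<in> F},
    tail = tail G, head = head G\<rparr>"
  have T: "verts T = verts G" "arcs T \<subseteq> arcs G" "tail T = tail G" "head T = head G"
    by (auto simp: T_def)
  have F: "arcs_ends T = F"
    using assms(1) by (force simp: T_def arcs_ends_def arc_to_ends_def)
  have sub: "subgraph T G"
    by (intro subgraphI) (use T in \<open>auto simp: compatible_def wf_digraph_def\<close>)
  interpret D: digraph T by (rule digraph_subgraph[OF sub])
  have "symmetric T" using F assms(2) by (simp add: symmetric_def tree_on_def)
  then interpret T: graph T by (rule D.graphI)
  have "graph_tree T" using T.graph_tree_iff assms F T by simp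
  then have "graph_spanning_tree T G"
    using sub T by (simp add: graph_spanning_tree_def spanning_def)
  moreover have "leaves T = {v \<in> verts G. card (F `` {v}) = 1}"
    using T.leaves_eq F T by simp
  ultimately show ?thesis by (rule that)
qed

lemma finite_leaf_counts: "finite {card (leaves T) | T. graph_spanning_tree T G}"
proof (rule finite_subset)
  show "{card (leaves T) | T. graph_spanning_tree T G} \<subseteq> {..card (verts G)}"
    by (auto simp: graph_spanning_tree_def spanning_def leaves_def intro!: card_mono)
qed simp

lemma max_leaf_attained:
  assumes "Digraph_Component.connected G"
  obtains T where "graph_spanning_tree T G" "card (leaves T) = max_leaf G"
proof -
  have G: "verts G \<noteq> {}" "conn (arcs_ends G) (verts G)"
    using assms connected_iff by auto
  then obtain F where F: "F \<subseteq> arcs_ends G" "tree_on (verts G) F"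
    using tree_on_exists[OF sym_arcs_ends finite_verts] by blast
  obtain T where "graph_spanning_tree T G"
    using spanning_tree_of_relation[OF F G(1)] .
  then have "{card (leaves T) | T. graph_spanning_tree T G} \<noteq> {}" by blast
  from Max_in[OF finite_leaf_counts this] show ?thesis
    using that unfolding max_leaf_def by fastforce
qed

text \<open>Extend \<open>C\<close> to a connected dominating set \<open>A\<close>, take a spanning
  tree of \<open>A\<close> and hang all other vertices on it. These become leaves, and they form the
  boundary of \<open>A\<close>.\<close>

lemma card_boundary_le_max_leaf:
  assumes "Digraph_Component.connected G" "C \<subseteq> verts G" "C \<noteq> {}" "conn (arcs_ends G) C"
  shows "card (boundary (arcs_ends G) C) \<le> max_leaf G"
proof -
  have conn: "conn (arcs_ends G) (verts G)" using assms(1) connected_iff by simp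
  obtain A where A: "conn (arcs_ends G) A" "C \<subseteq> A" "A \<subseteq> verts G"
    "boundary (arcs_ends G) A = verts G - A"
    "card (boundary (arcs_ends G) C) \<le> card (boundary (arcs_ends G) A)"
    using dominating_extension[OF sym_arcs_ends arcs_ends_in_verts finite_verts conn assms(4,3,2)] .
  have A': "finite A" "A \<noteq> {}" using A assms(3) finite_subset[OF _ finite_verts] by auto
  obtain F0 where F0: "F0 \<subseteq> arcs_ends G" "tree_on A F0"
    using tree_on_exists[OF sym_arcs_ends A' A(1)] by blast
  have "\<exists>F\<subseteq>arcs_ends G. tree_on (A \<union> (verts G - A)) F \<and> (\<forall>v\<in>verts G - A. card (F `` {v}) = 1)"
  proof (rule tree_on_attach[OF sym_arcs_ends _ _ _ F0])
    show "\<exists>a\<in>A. (a, v) \<in> arcs_ends G" if "v \<in> verts G - A" for v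
      using that A(4) unfolding boundary_def by blast
  qed auto
  then obtain F where F: "F \<subseteq> arcs_ends G" "tree_on (verts G) F"
    "\<And>v. v \<in> verts G - A \<Longrightarrow> card (F `` {v}) = 1"
    using A(3) by (auto simp: Un_absorb1)
  obtain T where T: "graph_spanning_tree T G" "leaves T = {v \<in> verts G. card (F `` {v}) = 1}"
    using spanning_tree_of_relation[OF F(1,2)] A A' by blast
  have "card (verts G - A) \<le> card (leaves T)"
    using F(3) by (intro card_mono) (auto simp: T(2))
  also have "\<dots> \<le> max_leaf G"
    unfolding max_leaf_def using T(1) by (intro Max_ge finite_leaf_counts) blast
  finally show ?thesis using A(4,5) by simp
qed

section \<open>Lower bound, and upper bound for trees\<close>

lemma induced_graph:
  assumes "induced_subgraph H G"
  shows "graph H" "arcs_ends H = Restr (arcs_ends G) (verts H)" "verts H \<subseteq> verts G"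
proof -
  interpret H: digraph H by (rule digraphI_induced[OF assms])
  show "graph H" using induced_graph_imp_symmetric[OF sym_arcs assms] by (rule H.graphI)
  show "verts H \<subseteq> verts G" using assms by auto
  show "arcs_ends H = Restr (arcs_ends G) (verts H)"
    using induce_eq_iff_induced[OF assms] arcs_ends_induce by metis
qed

text \<open>Leaves of \<open>T\<close> are deleted one at a time: each has at most one neighbour in
  what remains, so connectedness survives. The form with an induced subgraph \<open>H\<close> serves
  whole graphs and components alike.\<close>

lemma card_leaves_le_RTD:
  assumes "induced_subgraph H G" "graph_spanning_tree T H"
  shows "card (leaves T) \<le> RTD (verts G) (connected_sets G)"
proof (rule RTD_ge_cube)
  note H = induced_graph[OF assms(1)]
  have T: "graph T" "graph_tree T" "verts T = verts H" "subgraph T H"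
    using assms(2) unfolding graph_spanning_tree_def graph_tree_def spanning_def by auto
  interpret T: graph T by (rule T(1))
  have TG: "arcs_ends T \<subseteq> arcs_ends G" using arcs_ends_mono[OF T(4)] H(2) by blast
  show "connected_sets G \<subseteq> Pow (verts G)" by (auto simp: connected_sets_eq)
  show "leaves T \<subseteq> verts T" by (auto simp: leaves_def)
  fix S assume S: "S \<subseteq> leaves T"
  have "finite (leaves T)" by (simp add: leaves_def)
  then have "finite S" using S by (rule finite_subset[rotated])
  then have "conn (arcs_ends T) (verts T - S)" using S
  proof (induction S rule: finite_induct)
    case empty
    then show ?case using T(2) T.graph_tree_iff by (simp add: tree_on_def)
  next
    case (insert v S)
    have "v \<in> ends (arcs_ends T) (verts T)" using insert.prems T.leaves_subset_ends by blast
    then have "conn (arcs_ends T) ((verts T - S) - {v})"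
      using insert by (intro conn_remove_leaf[OF T.sym_arcs_ends T.irrefl_arcs_ends])
        (auto simp: ends_def)
    then show ?case by (metis Diff_insert)
  qed
  then show "verts T - S \<in> connected_sets G"
    using conn_mono[OF TG] T(3) H(3) by (auto simp: connected_sets_eq)
qed simp

text \<open>Two vertices are required because the one-vertex tree has the class of \<open>{}\<close>
  and its vertex set, of recursive teaching dimension 1, but no vertex of degree 1.\<close>

lemma RTD_le_of_tree:
  assumes "graph_tree G" "2 \<le> card (verts G)"
  shows "RTD (verts G) (connected_sets G) \<le> card (leaves G)"
proof (rule RTD_le)
  let ?E = "arcs_ends G"
  show "connected_sets G \<subseteq> Pow (verts G)" by (auto simp: connected_sets_eq)
  have E: "acyc ?E" "conn ?E (verts G)"
    using assms(1) graph_tree_iff by (auto simp: tree_on_def)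
  fix \<D> assume \<D>: "\<D> \<subseteq> connected_sets G" "\<D> \<noteq> {}"
  have "finite \<D>"
    using \<D>(1) by (rule finite_subset) (simp add: connected_sets_eq)
  then obtain C where C: "C \<in> \<D>" and max: "\<And>C'. C' \<in> \<D> \<Longrightarrow> C \<subseteq> C' \<Longrightarrow> C = C'"
    using finite_has_maximal[OF _ \<D>(2)] by metis
  have CV: "C \<subseteq> verts G" "conn ?E C" "finite C"
    using C \<D>(1) finite_subset[OF _ finite_verts] by (auto simp: connected_sets_eq)
  have "teaching_set (verts G) \<D> C (ends ?E C)"
    unfolding teaching_set_def
  proof (intro conjI ballI)
    show "finite (ends ?E C)" "ends ?E C \<subseteq> verts G" using CV by (auto simp: ends_def)
    fix C' assume C': "C' \<in> \<D> - {C}"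
    then have "conn ?E C'" using \<D>(1) by (auto simp: connected_sets_eq)
    then have "\<not> ends ?E C \<subseteq> C'"
      using ends_hull[OF sym_arcs_ends irrefl_arcs_ends E(1) CV(3,2)] max C' by blast
    then show "\<exists>x\<in>ends ?E C. x \<in> C \<longleftrightarrow> x \<notin> C'" by (auto simp: ends_def)
  qed
  moreover have "card (ends ?E C) \<le> card (leaves G)"
  proof (cases "C = {}")
    case False
    then show ?thesis
      using card_ends_mono[OF sym_arcs_ends irrefl_arcs_ends E(1) finite_verts E(2) CV(1) False CV(2)]
        ends_eq_leaves[OF assms(2) E(2)] by simp
  qed (simp add: ends_def)
  ultimately show "\<exists>C\<in>\<D>. \<exists>D. teaching_set (verts G) \<D> C D \<and> card D \<le> card (leaves G)"
    using C by blast
qed simp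

section \<open>Components and the bounds for arbitrary graphs\<close>

text \<open>A supremum of naturals dominates its terms once they are bounded; here
  \<open>card (verts G)\<close> bounds every leaf count.\<close>

lemma max_leaf_component_le_ell:
  assumes "H \<in> sccs" shows "max_leaf H \<le> ell G"
  unfolding ell_def
proof (rule cSUP_upper[OF assms])
  have "max_leaf H \<le> card (verts G)" if "H \<in> sccs" for H
  proof -
    have ind: "induced_subgraph H G" and "strongly_connected H" using that by (simp_all add: sccs_def)
    interpret H: graph H by (rule induced_graph(1)[OF ind])
    have "Digraph_Component.connected H"
      using \<open>strongly_connected H\<close> by (rule H.strongly_connected_imp_connected)
    then obtain T where T: "graph_spanning_tree T H" "card (leaves T) = max_leaf H"
      by (rule H.max_leaf_attained)
    then have "leaves T \<subseteq> verts G"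
      using induced_graph(3)[OF ind]
      by (auto simp: graph_spanning_tree_def spanning_def leaves_def)
    then show ?thesis using T(2) card_mono[OF finite_verts] by metis
  qed
  then show "bdd_above (max_leaf ` sccs)" by (auto simp: bdd_above_def)
qed

text \<open>A connected set and all its neighbours lie in one component, so its boundary is the same
  there as in \<open>G\<close>.\<close>

lemma card_boundary_le_ell:
  assumes "C \<subseteq> verts G" "C \<noteq> {}" "conn (arcs_ends G) C"
  shows "card (boundary (arcs_ends G) C) \<le> ell G"
proof -
  obtain c where c: "c \<in> C" using assms(2) by blast
  define H where "H = G \<restriction> scc_of c"
  have Hs: "H \<in> sccs"
    using scc_of_in_sccs_verts c assms(1) unfolding H_def in_sccs_verts_conv[symmetric] by blast
  then have ind: "induced_subgraph H G" and sc: "strongly_connected H" by (simp_all add: sccs_def)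
  note H' = induced_graph[OF ind]
  interpret H: graph H by (rule H'(1))
  \<comment> \<open>Reachability is symmetric here, so the strong component of \<open>c\<close>
    contains everything reachable from \<open>c\<close>.\<close>
  have vH: "v \<in> verts H" if "c \<rightarrow>\<^sup>* v" for v
    using that symmetric_reachable' by (auto simp: H_def scc_of_def)
  have cC: "c \<rightarrow>\<^sup>* v" if "v \<in> C" for v
  proof -
    have "(c, v) \<in> (arcs_ends G)\<^sup>*"
      using connD[OF assms(3) c that] by (metis Int_lower1 rtrancl_mono subsetD)
    then show ?thesis using reachable_conv' c assms(1) by blast
  qed
  then have CH: "C \<subseteq> verts H" using vH by blast
  have NH: "arcs_ends G `` C \<subseteq> verts H"
    using cC vH reachable_adj_trans by blast
  have "conn (arcs_ends H) C"
    using assms(3) CH by (subst conn_Restr_cong[of _ _ "arcs_ends G"]) (auto simp: H'(2))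
  moreover have "boundary (arcs_ends H) C = boundary (arcs_ends G) C"
    using CH NH by (auto simp: H'(2) boundary_def)
  moreover have "Digraph_Component.connected H"
    using sc by (rule H.strongly_connected_imp_connected)
  ultimately have "card (boundary (arcs_ends G) C) \<le> max_leaf H"
    using H.card_boundary_le_max_leaf CH assms(2) by metis
  then show ?thesis using max_leaf_component_le_ell[OF Hs] by linarith
qed

text \<open>The summand 1 pays for the positive example \<open>x\<close>; \<open>ell G\<close> pays
  for the boundary.\<close>

lemma RTD_le_ell: "RTD (verts G) (connected_sets G) \<le> ell G + 1"
proof (rule RTD_le)
  let ?E = "arcs_ends G"
  show "connected_sets G \<subseteq> Pow (verts G)" by (auto simp: connected_sets_eq)
  fix \<D> assume \<D>: "\<D> \<subseteq> connected_sets G" "\<D> \<noteq> {}"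
  have fin: "finite \<D>"
    using \<D>(1) by (rule finite_subset) (simp add: connected_sets_eq)
  show "\<exists>C\<in>\<D>. \<exists>D. teaching_set (verts G) \<D> C D \<and> card D \<le> ell G + 1"
  proof (cases "\<D> = {{}}")
    case True
    have "teaching_set (verts G) \<D> {} {}" unfolding teaching_set_def True by simp
    then show ?thesis using True by force
  next
    case False
    \<comment> \<open>Minimality is taken among nonempty members only; the empty set, if present, is
      excluded by \<open>x\<close>.\<close>
    then have "finite (\<D> - {{}})" "\<D> - {{}} \<noteq> {}" using \<D>(2) fin by auto
    from finite_has_minimal[OF this]
    obtain C where C: "C \<in> \<D>" "C \<noteq> {}"
      and min: "\<And>C'. C' \<in> \<D> - {{}} \<Longrightarrow> C' \<subseteq> C \<Longrightarrow> C = C'"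
      by (metis Diff_iff insertI1)
    obtain x where x: "x \<in> C" using C by blast
    have CV: "C \<subseteq> verts G" "conn ?E C" using C \<D>(1) by (auto simp: connected_sets_eq)
    have bV: "boundary ?E C \<subseteq> verts G" using arcs_ends_in_verts by (auto simp: boundary_def)
    have "teaching_set (verts G) \<D> C (insert x (boundary ?E C))"
      unfolding teaching_set_def
    proof (intro conjI ballI)
      show "finite (insert x (boundary ?E C))" using finite_subset[OF bV] by simp
      show "insert x (boundary ?E C) \<subseteq> verts G" using bV x CV by blast
      fix C' assume C': "C' \<in> \<D> - {C}"
      then have conn: "conn ?E C'" using \<D>(1) by (auto simp: connected_sets_eq)
      show "\<exists>y\<in>insert x (boundary ?E C). y \<in> C \<longleftrightarrow> y \<notin> C'"
      proof (cases "x \<in> C'")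
        case True
        \<comment> \<open>A walk in \<open>C'\<close> starting at \<open>x\<close> must leave
          \<open>C\<close>; the first vertex outside lies in the boundary and in \<open>C'\<close>,
          so it separates the two.\<close>
        then have "\<not> C' \<subseteq> C" using min C' by blast
        then obtain a v where "a \<in> C' \<inter> C" "v \<in> C' - C' \<inter> C" "(a, v) \<in> ?E"
          using conn_exit[OF conn, of "C' \<inter> C"] x True by blast
        then show ?thesis by (auto simp: boundary_def)
      qed (use x in blast)
    qed
    moreover have "card (insert x (boundary ?E C)) \<le> ell G + 1"
      using card_boundary_le_ell[OF CV(1) C(2) CV(2)]
        card_insert_le_m1[of "ell G + 1" "boundary ?E C" x] by simp
    ultimately show ?thesis using C by blast
  qed
qed simp

lemma max_leaf_le_RTD:
  assumes "induced_subgraph H G" "Digraph_Component.connected H"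
  shows "max_leaf H \<le> RTD (verts G) (connected_sets G)"
proof -
  interpret H: graph H by (rule induced_graph(1)[OF assms(1)])
  obtain T where "graph_spanning_tree T H" "card (leaves T) = max_leaf H"
    using assms(2) by (rule H.max_leaf_attained)
  then show ?thesis using card_leaves_le_RTD[OF assms(1)] by metis
qed

lemma ell_le_RTD: "ell G \<le> RTD (verts G) (connected_sets G)"
\<comment> \<open>Without components \<open>ell G\<close> is the supremum of the empty set, which is
  0.\<close>
proof (cases "sccs = {}")
  case False
  then show ?thesis
    unfolding ell_def
  proof (rule cSUP_least)
    fix H assume "H \<in> sccs"
    then have ind: "induced_subgraph H G" and "strongly_connected H" by (simp_all add: sccs_def)
    interpret H: graph H by (rule induced_graph(1)[OF ind])
    show "max_leaf H \<le> RTD (verts G) (connected_sets G)"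
      using max_leaf_le_RTD[OF ind] H.strongly_connected_imp_connected \<open>strongly_connected H\<close>
      by blast
  qed
qed (simp add: ell_def)

text \<open>For the lower bound, the tree serves as its own spanning tree.\<close>

lemma RTD_tree:
  assumes "graph_tree G" "2 \<le> card (verts G)"
  shows "RTD (verts G) (connected_sets G) = card (leaves G)"
proof (rule antisym[OF RTD_le_of_tree[OF assms]])
  have "graph_spanning_tree G G"
    using assms(1) subgraph_refl by (simp add: graph_spanning_tree_def spanning_def)
  then show "card (leaves G) \<le> RTD (verts G) (connected_sets G)"
    by (rule card_leaves_le_RTD[OF induced_subgraph_refl])
qed

end

theorem theorem6:
  shows "(\<forall>T :: ('a, 'b) pre_digraph.
            graph_tree T \<and> 2 \<le> card (verts T) \<longrightarrow>
              RTD (verts T) (connected_sets T) = card (leaves T)) \<and>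
         (\<forall>G :: ('a, 'b) pre_digraph.
            graph G \<and> Digraph_Component.connected G \<longrightarrow>
              max_leaf G \<le> RTD (verts G) (connected_sets G)) \<and>
         (\<forall>G :: ('a, 'b) pre_digraph.
            graph G \<longrightarrow>
              ell G \<le> RTD (verts G) (connected_sets G) \<and>
              RTD (verts G) (connected_sets G) \<le> ell G + 1)"
proof (intro conjI allI impI; (elim conjE)?)
  fix T :: "('a, 'b) pre_digraph"
  assume T: "graph_tree T" "2 \<le> card (verts T)"
  then show "RTD (verts T) (connected_sets T) = card (leaves T)"
    by (intro graph.RTD_tree) (simp_all add: graph_tree_def)
next
  fix G :: "('a, 'b) pre_digraph"
  assume "graph G" and conn: "Digraph_Component.connected G"
  interpret graph G by fact
  show "max_leaf G \<le> RTD (verts G) (connected_sets G)"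
    by (rule max_leaf_le_RTD[OF induced_subgraph_refl conn])
qed (rule graph.ell_le_RTD graph.RTD_le_ell, assumption)+

end
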